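(* Let $G=(V,E)$ be a DAG with topological order $v_1,\ldots,v_{|V|}$, let $i\in\{1,\ldots,|V|\}$, and for $t\in\{0,\ldots,|V|\}$ let $S_t$ be the support of $G_t=G[\{v_1,\ldots,v_t\}]$. Then for every $u\in S_{i-1}$: $u$ reaches $v_i$ if and only if either $(u,v_i)\in E$, or there exists an edge $(v_j,v_i)\in E$ such that $u\in S_{i-1}\cap S_{j-1}$ and $u$ reaches $v_j$. Consequently, the procedure that, for each $u\in S_{i-1}$, marks $u$ as reaching $v_i$ exactly when one of these two conditions holds (using the known reachability from $S_{j-1}$ to $v_j$ for each in-neighbor $v_j$ of $v_i$) correctly computes which vertices of $S_{i-1}$ reach $v_i$.
   Context: A topological order is an ordering of the vertices such that every edge goes from an earlier to a later vertex; $G_0$ is the empty graph. In a directed graph $H$, $u$ reaches $v$ if there is a path (sequence of distinct vertices, consecutive ones joined by edges of $H$, at least one vertex) from $u$ to $v$ in $H$. An antichain of $H$ is a set of vertices no one of which reaches a different one in $H$. A set $A$ reaches $v$ if some $u\in A$ reaches $v$. For antichains $A,B$ of $H$ of the same size, $B$ dominates $A$ (in $H$) if for every $b\in B$, $A$ reaches $b$ in $H$; antichains of different sizes are not related. An $H$-frontier antichain is an antichain of $H$ not dominated in $H$ by any other antichain of $H$. The support $S_t$ of $G_t$ is the union of all $G_t$-frontier antichains. *)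

theory Defs
  imports "Graph_Theory.Graph_Theory"
begin

locale dag = digraph +
  assumes no_cycle: "\<not> (\<exists>p. cycle p)"

text \<open>Vertices are numbered from 1; values of \<open>v\<close> outside the index range are irrelevant.\<close>

definition topological_order :: "('a, 'b) pre_digraph \<Rightarrow> (nat \<Rightarrow> 'a) \<Rightarrow> bool" where
  "topological_order G v \<longleftrightarrow>
     bij_betw v {1..card (verts G)} (verts G) \<and>
     (\<forall>a\<in>{1..card (verts G)}. \<forall>b\<in>{1..card (verts G)}. v a \<rightarrow>\<^bsub>G\<^esub> v b \<longrightarrow> a < b)"

definition prefix_graph :: "('a, 'b) pre_digraph \<Rightarrow> (nat \<Rightarrow> 'a) \<Rightarrow> nat \<Rightarrow> ('a, 'b) pre_digraph" where
  "prefix_graph G v t = G \<restriction> (v ` {1..t})"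

definition reaches :: "('a, 'b) pre_digraph \<Rightarrow> 'a \<Rightarrow> 'a \<Rightarrow> bool" where
  "reaches H u w \<longleftrightarrow> (\<exists>p. vpath p H \<and> hd p = u \<and> last p = w)"

lemma (in wf_digraph) reaches_iff_reachable: "reaches G u w \<longleftrightarrow> u \<rightarrow>\<^sup>*\<^bsub>G\<^esub> w"
  by (simp add: reaches_def reachable_vpath_conv)

definition set_reaches :: "('a, 'b) pre_digraph \<Rightarrow> 'a set \<Rightarrow> 'a \<Rightarrow> bool" where
  "set_reaches H A w \<longleftrightarrow> (\<exists>u\<in>A. reaches H u w)"

definition antichain :: "('a, 'b) pre_digraph \<Rightarrow> 'a set \<Rightarrow> bool" where
  "antichain H A \<longleftrightarrow> A \<subseteq> verts H \<and> (\<forall>x\<in>A. \<forall>y\<in>A. x \<noteq> y \<longrightarrow> \<not> reaches H x y)"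

text \<open>\<open>antichain_dominates H B A\<close> reads ``\<open>B\<close> dominates \<open>A\<close> in \<open>H\<close>''; it is meant for finite \<open>H\<close>,
  where \<open>card\<close> is the size of an antichain.\<close>

definition antichain_dominates :: "('a, 'b) pre_digraph \<Rightarrow> 'a set \<Rightarrow> 'a set \<Rightarrow> bool" where
  "antichain_dominates H B A \<longleftrightarrow>
     antichain H A \<and> antichain H B \<and> card A = card B \<and> (\<forall>b\<in>B. set_reaches H A b)"

definition frontier_antichain :: "('a, 'b) pre_digraph \<Rightarrow> 'a set \<Rightarrow> bool" where
  "frontier_antichain H A \<longleftrightarrow>
     antichain H A \<and> \<not> (\<exists>B. antichain H B \<and> B \<noteq> A \<and> antichain_dominates H B A)"

definition support :: "('a, 'b) pre_digraph \<Rightarrow> (nat \<Rightarrow> 'a) \<Rightarrow> nat \<Rightarrow> 'a set" where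
  "support G v t = \<Union> {A. frontier_antichain (prefix_graph G v t) A}"

text \<open>One step of the procedure: the vertices of the support of the \<open>(i - 1)\<close>-st prefix graph marked
  as reaching \<open>v i\<close>, given a table in which \<open>known j u\<close> records whether \<open>u\<close> reaches \<open>v j\<close>.
  Entries are consulted only for in-neighbours \<open>v j\<close> of \<open>v i\<close> and only at vertices \<open>u\<close> of the
  support of the \<open>(j - 1)\<close>-st prefix graph.\<close>

definition marked ::
  "('a, 'b) pre_digraph \<Rightarrow> (nat \<Rightarrow> 'a) \<Rightarrow> (nat \<Rightarrow> 'a \<Rightarrow> bool) \<Rightarrow> nat \<Rightarrow> 'a set" where
  "marked G v known i =
     {u \<in> support G v (i - 1).
        u \<rightarrow>\<^bsub>G\<^esub> v i \<or>
        (\<exists>j\<in>{1..card (verts G)}. v j \<rightarrow>\<^bsub>G\<^esub> v i \<and>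
           u \<in> support G v (i - 1) \<inter> support G v (j - 1) \<and> known j u)}"

end

theory Submission
  imports Defs
begin

text \<open>The key point is that the restriction \<open>A \<inter> V(G\<^sub>s)\<close> of a \<open>G\<^sub>t\<close>-frontier antichain \<open>A\<close> to an
  earlier prefix is again a frontier antichain: if \<open>B\<close> dominates it in \<open>G\<^sub>s\<close>, then
  \<open>B \<union> (A - V(G\<^sub>s))\<close> dominates \<open>A\<close> in \<open>G\<^sub>t\<close>. Hence a vertex of \<open>S\<^sub>i\<^sub>-\<^sub>1\<close> that reaches \<open>v\<^sub>j\<close> and
  differs from it lies in \<open>S\<^sub>j\<^sub>-\<^sub>1\<close>, and the characterisation is obtained by splitting off the last edge of
  a path to \<open>v\<^sub>i\<close>.\<close>

lemma topological_order_adj_in_prefix: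
  assumes "wf_digraph G" "topological_order G v" "t \<le> card (verts G)"
    and "x \<rightarrow>\<^bsub>G\<^esub> y" "y \<in> v ` {1..t}"
  shows "x \<in> v ` {1..t}"
proof -
  interpret wf_digraph G by fact
  from assms(5) obtain b where b: "b \<in> {1..t}" "y = v b" by blast
  have "x \<in> verts G" using assms(4) by auto
  then have "x \<in> v ` {1..card (verts G)}"
    using assms(2) unfolding topological_order_def bij_betw_def by simp
  then obtain a where a: "a \<in> {1..card (verts G)}" "x = v a" by blast
  have "b \<in> {1..card (verts G)}" using b assms(3) by auto
  with assms(2,4) a b have "a < b" by (auto simp: topological_order_def)
  with a b show ?thesis by auto
qed

text \<open>Edges increase the index, so each prefix contains all in-neighbours of its vertices.
  Following a path backwards from an end in the prefix therefore never leaves the prefix.\<close>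

lemma reachable_prefix_graph:
  assumes "wf_digraph G" "topological_order G v" "t \<le> card (verts G)"
    and "x \<rightarrow>\<^sup>*\<^bsub>G\<^esub> y" "y \<in> v ` {1..t}"
  shows "x \<in> v ` {1..t} \<and> x \<rightarrow>\<^sup>*\<^bsub>prefix_graph G v t\<^esub> y"
proof -
  interpret wf_digraph G by fact
  interpret P: wf_digraph "prefix_graph G v t"
    unfolding prefix_graph_def by (rule wellformed_induce_subgraph)
  from assms(4) show ?thesis
  proof (induct rule: converse_reachable_induct)
    case base
    have "verts (prefix_graph G v t) = v ` {1..t}" by (simp add: prefix_graph_def)
    with assms(5) show ?case by (metis P.reachable_refl)
  next
    case (step x z)
    then have z: "z \<in> v ` {1..t}" "z \<rightarrow>\<^sup>*\<^bsub>prefix_graph G v t\<^esub> y" by auto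
    have x: "x \<in> v ` {1..t}"
      using topological_order_adj_in_prefix[OF assms(1-3) step(1) z(1)] .
    obtain e where "e \<in> arcs G" "tail G e = x" "head G e = z"
      using step(1) by auto
    with x z(1) have "e \<in> arcs (prefix_graph G v t)"
        "arc_to_ends (prefix_graph G v t) e = (x, z)"
      unfolding arc_to_ends_def prefix_graph_def by simp_all
    then have "x \<rightarrow>\<^bsub>prefix_graph G v t\<^esub> z"
      unfolding arcs_ends_def by force
    with x z show ?case by (blast intro: P.adj_reachable_trans)
  qed
qed

text \<open>This allows antichains of different prefix graphs to be compared through the single
  relation \<open>reaches G\<close>.\<close>

lemma reaches_prefix_graph_iff:
  assumes "wf_digraph G" "topological_order G v" "t \<le> card (verts G)"
    and "y \<in> v ` {1..t}"
  shows "reaches (prefix_graph G v t) x y \<longleftrightarrow> reaches G x y"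
proof -
  interpret wf_digraph G by fact
  interpret P: wf_digraph "prefix_graph G v t"
    unfolding prefix_graph_def by (rule wellformed_induce_subgraph)
  have sub: "v ` {1..t} \<subseteq> verts G"
    using assms(2,3) unfolding topological_order_def bij_betw_def by auto
  have "subgraph (prefix_graph G v t) G"
    unfolding prefix_graph_def using sub
    by (intro induced_imp_subgraph induced_induce)
  then show ?thesis
    unfolding P.reaches_iff_reachable reaches_iff_reachable
    using reachable_prefix_graph[OF assms(1-3)] assms(4) reachable_mono by metis
qed

lemma antichain_prefix_graph_iff:
  assumes "wf_digraph G" "topological_order G v" "t \<le> card (verts G)"
  shows "antichain (prefix_graph G v t) A \<longleftrightarrow>
    A \<subseteq> v ` {1..t} \<and> (\<forall>x\<in>A. \<forall>y\<in>A. x \<noteq> y \<longrightarrow> \<not> reaches G x y)"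
proof -
  have "verts (prefix_graph G v t) = v ` {1..t}" by (simp add: prefix_graph_def)
  then show ?thesis
    using reaches_prefix_graph_iff[OF assms] unfolding antichain_def
    by (metis subsetD)
qed

lemma frontier_antichain_restrict_prefix:
  assumes G: "wf_digraph G" "topological_order G v" and t: "t \<le> card (verts G)" and "s \<le> t"
    and A: "frontier_antichain (prefix_graph G v t) A"
  shows "frontier_antichain (prefix_graph G v s) (A \<inter> v ` {1..s})"
proof -
  interpret wf_digraph G by fact
  have s: "s \<le> card (verts G)" using t \<open>s \<le> t\<close> by simp
  have mono: "v ` {1..s} \<subseteq> v ` {1..t}" using \<open>s \<le> t\<close> by auto
  note anti_s = antichain_prefix_graph_iff[OF G s]
  note anti_t = antichain_prefix_graph_iff[OF G t]
  note rs = reaches_prefix_graph_iff[OF G s]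
  note rt = reaches_prefix_graph_iff[OF G t]
  let ?A = "A \<inter> v ` {1..s}"
  have A': "A \<subseteq> v ` {1..t}" "\<And>x y. x \<in> A \<Longrightarrow> y \<in> A \<Longrightarrow> x \<noteq> y \<Longrightarrow> \<not> reaches G x y"
    using A unfolding frontier_antichain_def anti_t by blast+
  have "antichain (prefix_graph G v s) ?A"
    unfolding anti_s using A'(2) by blast
  moreover have "B = ?A" if B: "antichain (prefix_graph G v s) B"
    "antichain_dominates (prefix_graph G v s) B ?A" for B
  proof (rule ccontr)
    assume "B \<noteq> ?A"
    have B': "B \<subseteq> v ` {1..s}" "\<And>x y. x \<in> B \<Longrightarrow> y \<in> B \<Longrightarrow> x \<noteq> y \<Longrightarrow> \<not> reaches G x y"
      using B(1) unfolding anti_s by blast+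
    have card: "card B = card ?A"
      using B(2) by (simp add: antichain_dominates_def)
    have dom: "\<exists>a\<in>?A. reaches G a b" if "b \<in> B" for b
      using B(2) that B'(1) rs
      unfolding antichain_dominates_def set_reaches_def by blast
    let ?C = "B \<union> (A - v ` {1..s})"
    \<comment> \<open>Some \<open>a'\<close> in \<open>?A\<close> reaches \<open>b\<close>, so a
      path from \<open>b\<close> to \<open>a\<close> would connect two elements of \<open>A\<close>;
      they are distinct because only \<open>a'\<close> lies in the \<open>s\<close>-prefix.\<close>
    have "\<not> reaches G b a" if "b \<in> B" "a \<in> A - v ` {1..s}" for a b
    proof
      assume "reaches G b a"
      moreover obtain a' where "a' \<in> ?A" "reaches G a' b" using dom \<open>b \<in> B\<close> by blast
      ultimately have "reaches G a' a"
        unfolding reaches_iff_reachable by (blast intro: reachable_trans)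
      with \<open>a' \<in> ?A\<close> that A'(2) show False by blast
    qed
    \<comment> \<open>A vertex outside the \<open>s\<close>-prefix reaches nothing inside
      it.\<close>
    moreover have "\<not> reaches G a b" if "b \<in> B" "a \<in> A - v ` {1..s}" for a b
      using that B'(1) reachable_prefix_graph[OF G s]
      unfolding reaches_iff_reachable by blast
    ultimately have C: "antichain (prefix_graph G v t) ?C"
      unfolding anti_t using A' B' mono by blast
    \<comment> \<open>The elements of \<open>?C\<close> that come from \<open>A\<close> are reached
      by themselves, through one-vertex paths.\<close>
    have refl: "reaches G a a" if "a \<in> A" for a
      using that A'(1) t G(2)
      unfolding reaches_iff_reachable topological_order_def bij_betw_def by fastforce
    have fin: "finite A" "finite B" using A'(1) B'(1) by (auto intro: finite_subset)
    \<comment> \<open>\<open>?C\<close> and \<open>A\<close> have the same part outside the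
      \<open>s\<close>-prefix, and their parts inside it, \<open>B\<close> and \<open>?A\<close>,
      have equal size by domination.\<close>
    have "card ?C = card B + card (A - v ` {1..s})"
      using fin B'(1) by (intro card_Un_disjoint) auto
    also have "\<dots> = card (?A \<union> (A - v ` {1..s}))"
      unfolding card using fin by (intro card_Un_disjoint[symmetric]) auto
    also have "?A \<union> (A - v ` {1..s}) = A" by blast
    finally have "card A = card ?C" ..
    moreover have "set_reaches (prefix_graph G v t) A c" if "c \<in> ?C" for c
    proof -
      have "c \<in> v ` {1..t}" using that C unfolding anti_t by blast
      then show ?thesis
        using that dom refl unfolding set_reaches_def rt[OF \<open>c \<in> v ` {1..t}\<close>] by blast
    qed
    ultimately have "antichain_dominates (prefix_graph G v t) ?C A"
      using A C unfolding frontier_antichain_def antichain_dominates_def by blast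
    \<comment> \<open>Inside the \<open>s\<close>-prefix, \<open>?C\<close> is \<open>B\<close>
      while \<open>A\<close> is \<open>?A\<close>.\<close>
    moreover have "?C \<noteq> A" using \<open>B \<noteq> ?A\<close> B'(1) by blast
    ultimately show False using A C unfolding frontier_antichain_def by blast
  qed
  ultimately show ?thesis unfolding frontier_antichain_def by blast
qed

lemma support_subset_prefix: "support G v t \<subseteq> v ` {1..t}"
  unfolding support_def frontier_antichain_def antichain_def prefix_graph_def by auto

text \<open>A frontier antichain through \<open>u\<close> still contains \<open>u\<close> after
  being cut down to the smaller prefix, and it remains a frontier antichain there.\<close>

lemma support_restrict_prefix:
  assumes "wf_digraph G" "topological_order G v" "t \<le> card (verts G)" "s \<le> t"
    and "u \<in> support G v t" "u \<in> v ` {1..s}"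
  shows "u \<in> support G v s"
proof -
  from assms(5) obtain A where "frontier_antichain (prefix_graph G v t) A" "u \<in> A"
    unfolding support_def by blast
  with frontier_antichain_restrict_prefix[OF assms(1-4)] assms(6) show ?thesis
    unfolding support_def by blast
qed

lemma support_reaches_iff:
  assumes G: "wf_digraph G" "topological_order G v"
    and i: "i \<in> {1..card (verts G)}" and u: "u \<in> support G v (i - 1)"
  shows "reaches G u (v i) \<longleftrightarrow>
    u \<rightarrow>\<^bsub>G\<^esub> v i \<or>
    (\<exists>j\<in>{1..card (verts G)}. v j \<rightarrow>\<^bsub>G\<^esub> v i \<and>
       u \<in> support G v (i - 1) \<inter> support G v (j - 1) \<and> reaches G u (v j))"
    (is "?L \<longleftrightarrow> ?R")
proof -
  interpret wf_digraph G by fact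
  have inj: "inj_on v {1..card (verts G)}" and img: "v ` {1..card (verts G)} = verts G"
    using G(2) unfolding topological_order_def bij_betw_def by auto
  obtain k where k: "k \<in> {1..i - 1}" "u = v k"
    using subsetD[OF support_subset_prefix u] by blast
  have kn: "k \<in> {1..card (verts G)}" "k \<noteq> i" using k i by auto
  show ?thesis
  proof
    assume ?L
    then have uvi: "u \<in> verts G" "(u, v i) \<in> (arcs_ends G)\<^sup>*"
      unfolding reaches_iff_reachable reachable_conv by auto
    \<comment> \<open>The index of \<open>u\<close> is at most \<open>i - 1\<close>, so the path to
      \<open>v i\<close> is not trivial and has a last edge.\<close>
    moreover have "u \<noteq> v i" using inj kn i k(2) by (auto dest: inj_onD)
    ultimately obtain w where uw: "(u, w) \<in> (arcs_ends G)\<^sup>*" and wi: "w \<rightarrow>\<^bsub>G\<^esub> v i"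
      by (blast elim: rtranclE)
    have w: "u \<rightarrow>\<^sup>*\<^bsub>G\<^esub> w" "w \<rightarrow>\<^bsub>G\<^esub> v i"
      using uw wi uvi adj_in_verts(1)[OF wi] unfolding reachable_conv by auto
    \<comment> \<open>If the last edge starts at \<open>u\<close>, the first disjunct holds.
      Otherwise its tail \<open>w\<close> is the \<open>v j\<close> of the second.\<close>
    show ?R
    proof (cases "w = u")
      case False
      have "w \<in> v ` {1..card (verts G)}" unfolding img using adj_in_verts(1)[OF wi] .
      then obtain j where j: "j \<in> {1..card (verts G)}" "w = v j" by blast
      have "j < i" using w j i G(2) by (auto simp: topological_order_def)
      have "u \<in> v ` {1..j}"
        using reachable_prefix_graph[OF G, of j u w] w j by auto
      then obtain l where l: "l \<in> {1..j}" "u = v l" by blast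
      \<comment> \<open>Reaching \<open>v j\<close> only bounds the index of \<open>u\<close> by
        \<open>j\<close>; \<open>u \<noteq> v j\<close> improves this to \<open>j - 1\<close>. As
        \<open>j - 1 \<le> i - 1\<close>, membership in the support then passes down from
        \<open>i - 1\<close> to \<open>j - 1\<close>.\<close>
      with False j have "l \<noteq> j" by auto
      with l have "l \<in> {1..j - 1}" by auto
      with l(2) have "u \<in> v ` {1..j - 1}" by blast
      then have "u \<in> support G v (j - 1)"
        using support_restrict_prefix[OF G, of "i - 1" "j - 1" u] u i \<open>j < i\<close> by auto
      with u w j show ?thesis unfolding reaches_iff_reachable by blast
    qed (use wi in simp)
  next
    assume ?R
    then show ?L unfolding reaches_iff_reachable
      by (blast intro: reachable_adj_trans)
  qed
qed

theorem theorem3: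
  fixes G :: "('a, 'b) pre_digraph" and v :: "nat \<Rightarrow> 'a" and i :: nat
  assumes "dag G"
    and "topological_order G v"
    and "i \<in> {1..card (verts G)}"
  shows "(\<forall>u\<in>support G v (i - 1).
            reaches G u (v i) \<longleftrightarrow>
              u \<rightarrow>\<^bsub>G\<^esub> v i \<or>
              (\<exists>j\<in>{1..card (verts G)}. v j \<rightarrow>\<^bsub>G\<^esub> v i \<and>
                 u \<in> support G v (i - 1) \<inter> support G v (j - 1) \<and> reaches G u (v j)))
       \<and> (\<forall>known.
            (\<forall>j\<in>{1..card (verts G)}. v j \<rightarrow>\<^bsub>G\<^esub> v i \<longrightarrow>
               (\<forall>u\<in>support G v (j - 1). known j u \<longleftrightarrow> reaches G u (v j))) \<longrightarrow>
            marked G v known i = {u \<in> support G v (i - 1). reaches G u (v i)})"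
proof -
  have "wf_digraph G"
    using \<open>dag G\<close> by (simp add: dag_def digraph_def fin_digraph_def)
  note iff = support_reaches_iff[OF this assms(2,3)]
  show ?thesis
  proof (intro conjI ballI allI impI)
    fix known
    assume known: "\<forall>j\<in>{1..card (verts G)}. v j \<rightarrow>\<^bsub>G\<^esub> v i \<longrightarrow>
      (\<forall>u\<in>support G v (j - 1). known j u \<longleftrightarrow> reaches G u (v j))"
    have "u \<in> marked G v known i \<longleftrightarrow> u \<in> support G v (i - 1) \<and> reaches G u (v i)" for u
    proof (cases "u \<in> support G v (i - 1)")
      case True
      \<comment> \<open>\<open>marked\<close> consults \<open>known j u\<close> only for
        \<open>u\<close> in \<open>support G v (j - 1)\<close> and an edge from \<open>v j\<close>
        to \<open>v i\<close>, which is exactly where the table is assumed correct.\<close>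
      show ?thesis unfolding iff[OF True] using True known by (auto simp: marked_def)
    qed (simp add: marked_def)
    then show "marked G v known i = {u \<in> support G v (i - 1). reaches G u (v i)}" by blast
  qed (rule iff)
qed

end
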